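(* Let $m,n\geq 1$ and $R\cong S\times T$ with $S=\prod_{i=1}^{m}R_{i}$ and $T=\prod_{j=1}^{n}\mathbb{F}_{j}$, where each $R_i$ is a local principal ideal ring with finitely many ideals that is not a field and each $\mathbb{F}_j$ is a field; let $n_i$ be the number of non-trivial (nonzero proper) ideals of $R_i$. Then $sdim(G(R))=\left(\prod_{i=1}^{m}(n_{i}+2)\right)2^{n}-2^{m+n-1}-2$.
   Context: All rings are commutative with identity. $I(R)$ is the set of non-trivial (nonzero proper) ideals of $R$; $G(R)$ is the graph with vertex set $I(R)$ in which distinct $I,J$ are adjacent iff $I\cap J\neq 0$. For a graph $G$ with distance $d$, two vertices $u,v$ are strongly resolved by a vertex $w$ if $d(w,u)=d(w,v)+d(v,u)$ or $d(w,v)=d(w,u)+d(u,v)$. A set $W$ of vertices is a strong resolving set if every two distinct vertices are strongly resolved by some vertex of $W$; $sdim(G)$ is the minimum cardinality of a strong resolving set. *)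

theory Defs
  imports
    "HOL-Algebra.Chinese_Remainder"
    "Graph_Theory.Pair_Digraph"
    "Graph_Theory.Shortest_Path"
begin

definition nontrivial_ideals :: "('a, 'm) ring_scheme \<Rightarrow> 'a set set" where
  "nontrivial_ideals R = {I. ideal I R \<and> I \<noteq> {\<zero>\<^bsub>R\<^esub>} \<and> I \<noteq> carrier R}"

definition local_ring :: "('a, 'm) ring_scheme \<Rightarrow> bool" where
  "local_ring R \<longleftrightarrow> cring R \<and> (\<exists>!M. maximalideal M R)"

definition principal_ideal_ring :: "('a, 'm) ring_scheme \<Rightarrow> bool" where
  "principal_ideal_ring R \<longleftrightarrow> cring R \<and> (\<forall>I. ideal I R \<longrightarrow> principalideal I R)"

text \<open>A simple graph is encoded as a symmetric loop-free digraph.\<close>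

definition intersection_graph :: "('a, 'm) ring_scheme \<Rightarrow> 'a set pair_pre_digraph" where
  "intersection_graph R =
     \<lparr>pverts = nontrivial_ideals R,
      parcs = {(I, J). I \<in> nontrivial_ideals R \<and> J \<in> nontrivial_ideals R \<and>
                       I \<noteq> J \<and> I \<inter> J \<noteq> {\<zero>\<^bsub>R\<^esub>}}\<rparr>"

lemma intersection_graph_wf: "wf_digraph (with_proj (intersection_graph R))"
  by unfold_locales (auto simp: intersection_graph_def)

lemma intersection_graph_symmetric: "symmetric (with_proj (intersection_graph R))"
  by (auto simp: symmetric_def sym_def arcs_ends_def arc_to_ends_def intersection_graph_def)

text \<open>With unit arc costs, the infimum of the walk costs is the number of edges of a shortest
  walk, and it is \<open>\<infinity>\<close> for vertices in different components.\<close>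

definition graph_dist :: "('a, 'b) pre_digraph \<Rightarrow> 'a \<Rightarrow> 'a \<Rightarrow> ereal" where
  "graph_dist G u v = wf_digraph.\<mu> G (\<lambda>_. 1) u v"

definition strongly_resolves :: "('a, 'b) pre_digraph \<Rightarrow> 'a \<Rightarrow> 'a \<Rightarrow> 'a \<Rightarrow> bool" where
  "strongly_resolves G w u v \<longleftrightarrow>
     graph_dist G w u = graph_dist G w v + graph_dist G v u \<or>
     graph_dist G w v = graph_dist G w u + graph_dist G u v"

definition strong_resolving_set :: "('a, 'b) pre_digraph \<Rightarrow> 'a set \<Rightarrow> bool" where
  "strong_resolving_set G W \<longleftrightarrow>
     W \<subseteq> verts G \<and>
     (\<forall>u\<in>verts G. \<forall>v\<in>verts G. u \<noteq> v \<longrightarrow> (\<exists>w\<in>W. strongly_resolves G w u v))"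

text \<open>Finiteness is required because \<^const>\<open>card\<close> is \<open>0\<close> on infinite sets.\<close>

definition sdim :: "('a, 'b) pre_digraph \<Rightarrow> nat" where
  "sdim G = (LEAST k. \<exists>W. strong_resolving_set G W \<and> finite W \<and> card W = k)"

end

theory Submission
  imports Defs
begin

text \<open>
  The ideals of \<open>R\<close> are the tuples of ideals of the factors. In each factor any two nonzero ideals
  meet: the maximal ideal of \<open>R\<^sub>i\<close> is generated by a nilpotent \<open>p\<close>, and the last nonzero power of
  \<open>p\<close> lies in every nonzero ideal. Hence two ideals of \<open>R\<close> are adjacent iff their supports, subsets
  of an \<open>(m + n)\<close>-element set, meet. The graph has diameter at most 2, and a set \<open>W\<close> is strongly
  resolving iff the ideals outside \<open>W\<close> have distinct and pairwise intersecting supports. An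
  intersecting family on \<open>m + n\<close> points has at most \<open>2\<^bsup>m + n - 1\<^esup>\<close> members, and this is attained by
  the sets through a fixed point, because every nonempty set is the support of a proper ideal
  (for the full set this uses that some \<open>R\<^sub>i\<close> is not a field).
\<close>

section \<open>Strong resolving sets of graphs given by supports\<close>

text \<open>A set and its complement in \<open>K\<close> are disjoint, so \<open>F\<close> contains
  no complement of a member. Hence \<open>F\<close> and the family of complements are two disjoint
  families of equal size inside \<open>Pow K\<close>.\<close>

lemma card_intersecting_family:
  assumes "finite K" "K \<noteq> {}" "F \<subseteq> Pow K"
    and intersecting: "\<And>A B. A \<in> F \<Longrightarrow> B \<in> F \<Longrightarrow> A \<inter> B \<noteq> {}"
  shows "card F \<le> 2 ^ (card K - 1)"
proof -
  let ?C = "(\<lambda>A. K - A) ` F"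
  have fin: "finite F"
    using assms(1,3) by (meson finite_Pow_iff finite_subset)
  have "inj_on (\<lambda>A. K - A) F"
    using assms(3) by (intro inj_onI) blast
  then have "card ?C = card F"
    by (rule card_image)
  moreover have "F \<inter> ?C = {}"
    using intersecting by blast
  ultimately have "2 * card F = card (F \<union> ?C)"
    using fin by (simp add: card_Un_disjoint)
  also have "\<dots> \<le> card (Pow K)"
    using assms(1,3) by (intro card_mono) auto
  also have "\<dots> = 2 * 2 ^ (card K - 1)"
    using assms(1,2) by (simp add: card_Pow power_eq_if card_eq_0_iff)
  finally show ?thesis
    by simp
qed

text \<open>Abstracts the intersection graph to what the distances depend on: vertices carry
  nonempty subsets of \<open>K\<close>, and distinct vertices are adjacent iff these meet.
  \<open>s\<close> may be far from injective, but every nonempty subset occurs. The full set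
  supplies a common neighbour, the singletons supply the resolving vertices.\<close>

locale support_graph =
  fixes V :: "'v set" and s :: "'v \<Rightarrow> 'k set" and K :: "'k set" and G :: "'v pair_pre_digraph"
  assumes finite_V: "finite V" and finite_K: "finite K" and K_nonempty: "K \<noteq> {}"
    and support_image: "s ` V = Pow K - {{}}"
    and pverts_G: "pverts G = V"
    and parcs_G: "parcs G = {(u, v). u \<in> V \<and> v \<in> V \<and> u \<noteq> v \<and> s u \<inter> s v \<noteq> {}}"
begin

sublocale wf_digraph "with_proj G"
  by unfold_locales (auto simp: pverts_G parcs_G)

abbreviation d :: "'v \<Rightarrow> 'v \<Rightarrow> ereal" where
  "d \<equiv> graph_dist (with_proj G)"

lemma support_nonempty: "v \<in> V \<Longrightarrow> s v \<noteq> {}"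
  using support_image by blast

lemma support_subset: "v \<in> V \<Longrightarrow> s v \<subseteq> K"
  using support_image by blast

lemma support_surj:
  assumes "A \<subseteq> K" "A \<noteq> {}"
  obtains v where "v \<in> V" "s v = A"
  using assms support_image by (metis Diff_iff PowI image_iff singletonD)

lemma awalk_cost_unit: "awalk_cost (\<lambda>_. 1) p = real (length p)"
  by (induction p) auto

lemma dist_le: "awalk u p v \<Longrightarrow> d u v \<le> ereal (real (length p))"
  unfolding graph_dist_def using min_cost_le_walk_cost[of u p v "\<lambda>_. 1"]
  by (simp add: awalk_cost_unit)

text \<open>The distance is an infimum over walks. If there is no walk it is \<infinity>, so the
  bound covers that case as well.\<close>

lemma dist_ge:
  assumes "\<And>p. awalk u p v \<Longrightarrow> k \<le> length p"
  shows "ereal (real k) \<le> d u v"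
  unfolding graph_dist_def \<mu>_def using assms
  by (intro INF_greatest) (simp add: awalk_cost_unit)

lemma dist_self: "v \<in> V \<Longrightarrow> d v v = 0"
  using dist_le[of v "[]" v] dist_ge[of v v 0]
  by (intro antisym) (simp_all add: awalk_Nil_iff pverts_G flip: zero_ereal_def)

text \<open>A vertex of support \<open>K\<close> is adjacent to every other vertex, so vertices with
  disjoint supports are joined by a path of length 2 through it.\<close>

lemma dist_distinct:
  assumes "u \<in> V" "v \<in> V" "u \<noteq> v"
  shows "d u v = ereal (if s u \<inter> s v \<noteq> {} then 1 else 2)"
proof (cases "s u \<inter> s v = {}")
  case False
  then have "awalk u [(u, v)] v"
    using assms by (simp add: awalk_simps parcs_G pverts_G)
  from dist_le[OF this] have "d u v \<le> ereal 1"
    by simp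
  moreover have "1 \<le> length p" if "awalk u p v" for p
    using that assms(3) by (cases p) (auto simp: awalk_simps)
  then have "ereal 1 \<le> d u v"
    using dist_ge[of u v 1] by simp
  ultimately have "d u v = ereal 1"
    by (rule antisym)
  then show ?thesis
    using False by simp
next
  case True
  obtain w where w: "w \<in> V" "s w = K"
    using support_surj K_nonempty by blast
  \<comment> \<open>If \<open>w\<close> were one of the two vertices, the nonempty support of the
    other would lie in its support \<open>K\<close>, against disjointness.\<close>
  have "w \<noteq> u" "w \<noteq> v" "s u \<inter> s w \<noteq> {}" "s w \<inter> s v \<noteq> {}"
    using True w assms support_nonempty support_subset by blast+
  then have "awalk u [(u, w), (w, v)] v"
    using assms w by (simp add: awalk_simps parcs_G pverts_G)
  from dist_le[OF this] have "d u v \<le> ereal 2"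
    by simp
  \<comment> \<open>A walk of length 1 would be an arc between vertices with disjoint
    supports.\<close>
  moreover have "2 \<le> length p" if p: "awalk u p v" for p
  proof (cases p)
    case Nil
    then show ?thesis using p assms(3) by (simp add: awalk_simps)
  next
    case (Cons a q)
    then show ?thesis using p True by (cases q) (auto simp: awalk_simps parcs_G)
  qed
  then have "ereal 2 \<le> d u v"
    using dist_ge[of u v 2] by simp
  ultimately have "d u v = ereal 2"
    by (rule antisym)
  then show ?thesis
    using True by simp
qed

text \<open>If \<open>w\<close> in \<open>W\<close> resolves \<open>u\<close> and \<open>v\<close>
  outside \<open>W\<close>, all three distances are 1 or 2, so the equation can only read 2 = 1 + 1.
  Then \<open>u\<close> and \<open>v\<close> are adjacent and the support of \<open>w\<close> meets
  exactly one of theirs, so the supports differ. Conversely, a point \<open>a\<close> in only one of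
  the two supports yields a resolving vertex of support \<open>{a}\<close>.\<close>

lemma strong_resolving_set_iff:
  "strong_resolving_set (with_proj G) W \<longleftrightarrow>
     W \<subseteq> V \<and> inj_on s (V - W) \<and> (\<forall>u\<in>V - W. \<forall>v\<in>V - W. s u \<inter> s v \<noteq> {})"
  (is "?L \<longleftrightarrow> ?R")
proof
  assume L: ?L
  then have W: "W \<subseteq> V"
    by (simp add: strong_resolving_set_def pverts_G)
  have "s u \<noteq> s v \<and> s u \<inter> s v \<noteq> {}" if uv: "u \<in> V - W" "v \<in> V - W" "u \<noteq> v" for u v
  proof -
    obtain w where w: "w \<in> W" "strongly_resolves (with_proj G) w u v"
      using L uv unfolding strong_resolving_set_def with_proj_simps pverts_G by blast
    then have "w \<in> V" "w \<noteq> u" "w \<noteq> v"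
      using W uv by auto
    then show ?thesis
      using w(2) uv unfolding strongly_resolves_def
      by (auto simp: dist_distinct Int_commute split: if_splits)
  qed
  then show ?R
    using W support_nonempty unfolding inj_on_def by (metis Diff_iff Int_absorb)
next
  assume R: ?R
  have res: "\<exists>w\<in>W. d w v = d w u + d u v"
    if uv: "u \<in> V - W" "v \<in> V - W" and a: "a \<in> s u" "a \<notin> s v" for u v a
  proof -
    have "{a} \<subseteq> K"
      using a uv support_subset by blast
    then obtain w where w: "w \<in> V" "s w = {a}"
      using support_surj by blast
    \<comment> \<open>Outside \<open>W\<close> the support of \<open>w\<close> would have to meet
      that of \<open>v\<close>, but it is \<open>{a}\<close> and \<open>a\<close> is not in
      \<open>s v\<close>.\<close>
    have "w \<in> W"
      using R w uv(2) a(2) by fastforce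
    moreover have "u \<noteq> v" "w \<noteq> u" "w \<noteq> v" "s u \<inter> s v \<noteq> {}"
      using \<open>w \<in> W\<close> uv R a by auto
    then have "d w v = d w u + d u v"
      using w uv a by (simp add: dist_distinct)
    ultimately show ?thesis
      by blast
  qed
  have "\<exists>w\<in>W. strongly_resolves (with_proj G) w u v" if uv: "u \<in> V" "v \<in> V" "u \<noteq> v" for u v
  proof (cases "u \<in> W \<or> v \<in> W")
    case True
    then show ?thesis
      using uv unfolding strongly_resolves_def by (metis dist_self add_0)
  next
    case False
    then have "s u \<noteq> s v"
      using R uv by (auto simp: inj_on_def)
    then obtain a where "a \<in> s u \<and> a \<notin> s v \<or> a \<in> s v \<and> a \<notin> s u"
      by blast
    then show ?thesis
      using res[of u v a] res[of v u a] False uv unfolding strongly_resolves_def by blast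
  qed
  then show ?L
    using R by (simp add: strong_resolving_set_def pverts_G)
qed

lemma card_V_ge: "2 ^ (card K - 1) \<le> card V"
  and sdim_eq: "sdim (with_proj G) = card V - 2 ^ (card K - 1)"
proof -
  obtain x where x: "x \<in> K"
    using K_nonempty by blast
  \<comment> \<open>The sets through the fixed point \<open>x\<close> form an intersecting family of
    the maximal size; \<open>U\<close> picks one vertex for each of them, and \<open>V - U\<close>
    is the optimal resolving set.\<close>
  define F where "F = insert x ` Pow (K - {x})"
  define U where "U = inv_into V s ` F"
  have F: "F \<subseteq> s ` V"
    using x unfolding support_image F_def by auto
  have "inj_on (insert x) (Pow (K - {x}))"
    by (intro inj_onI) blast
  then have "card F = 2 ^ (card K - 1)"
    using x finite_K by (simp add: F_def card_image card_Pow)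
  then have cardU: "card U = 2 ^ (card K - 1)"
    unfolding U_def using F by (simp add: card_image inj_on_inv_into)
  have inv: "inv_into V s A \<in> V" "s (inv_into V s A) = A" if "A \<in> F" for A
    using inv_into_into[of A s V] f_inv_into_f[of A s V] that F by blast+
  then have U: "U \<subseteq> V" "inj_on s U"
    unfolding U_def by (auto simp: inj_on_def)
  have U_x: "x \<in> s u" if "u \<in> U" for u
    using that inv unfolding U_def by (auto simp: F_def)
  show ge: "2 ^ (card K - 1) \<le> card V"
    using card_mono[OF finite_V U(1)] cardU by simp
  have VU: "V - (V - U) = U"
    using U(1) by blast
  show "sdim (with_proj G) = card V - 2 ^ (card K - 1)"
    unfolding sdim_def
  proof (rule Least_equality)
    have "strong_resolving_set (with_proj G) (V - U)"
      unfolding strong_resolving_set_iff VU using U U_x by blast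
    moreover have "card (V - U) = card V - 2 ^ (card K - 1)"
      using U(1) finite_V cardU by (simp add: card_Diff_subset finite_subset)
    ultimately show "\<exists>W. strong_resolving_set (with_proj G) W \<and> finite W \<and>
        card W = card V - 2 ^ (card K - 1)"
      using finite_V by blast
  next
    fix k
    assume "\<exists>W. strong_resolving_set (with_proj G) W \<and> finite W \<and> card W = k"
    then obtain W where W: "W \<subseteq> V" "inj_on s (V - W)" "card W = k"
      "\<forall>u\<in>V - W. \<forall>v\<in>V - W. s u \<inter> s v \<noteq> {}"
      unfolding strong_resolving_set_iff by blast
    \<comment> \<open>Lower bound: the vertices outside \<open>W\<close> have distinct supports, and
      these supports form an intersecting family.\<close>
    have "card (V - W) = card (s ` (V - W))"
      using W(2) by (simp add: card_image)
    also have "\<dots> \<le> 2 ^ (card K - 1)"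
      using W(4) support_image finite_K K_nonempty by (intro card_intersecting_family) auto
    finally show "card V - 2 ^ (card K - 1) \<le> k"
      using W(1,3) finite_V by (simp add: card_Diff_subset finite_subset)
  qed
qed

end

section \<open>Supports of ideals\<close>

text \<open>The \<open>k\<close> points stand for the indecomposable factors of the ring. Taking
  \<open>I = J\<close> shows that exactly the zero ideal has empty support. The points are initial
  natural numbers so that the supports for a product of two rings can be put side by side by a
  shift.\<close>

definition ideal_support :: "('a, 'm) ring_scheme \<Rightarrow> nat \<Rightarrow> ('a set \<Rightarrow> nat set) \<Rightarrow> bool" where
  "ideal_support R k s \<longleftrightarrow> s ` {I. ideal I R} = Pow {..<k} \<and>
     (\<forall>I J. ideal I R \<longrightarrow> ideal J R \<longrightarrow> (I \<inter> J = {\<zero>\<^bsub>R\<^esub>} \<longleftrightarrow> s I \<inter> s J = {}))"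

text \<open>\<open>E\<close> is essential in the sense of module theory. It keeps the full set among
  the supports when the whole ring is removed from the ideals to obtain the vertices.\<close>

definition has_proper_essential_ideal :: "('a, 'm) ring_scheme \<Rightarrow> bool" where
  "has_proper_essential_ideal R \<longleftrightarrow> (\<exists>E. ideal E R \<and> E \<noteq> carrier R \<and>
     (\<forall>J. ideal J R \<longrightarrow> E \<inter> J = {\<zero>\<^bsub>R\<^esub>} \<longrightarrow> J = {\<zero>\<^bsub>R\<^esub>}))"

lemma ideal_zero_mem: "ideal I R \<Longrightarrow> \<zero>\<^bsub>R\<^esub> \<in> I"
  by (simp add: additive_subgroup.zero_closed ideal.axioms(1))

lemma ideal_subset_carrier: "ideal I R \<Longrightarrow> I \<subseteq> carrier R"
  by (rule additive_subgroup.a_subset[OF ideal.axioms(1)])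

lemma ideal_support_Int_iff:
  assumes "ideal_support R k s" "ideal I R" "ideal J R"
  shows "I \<inter> J = {\<zero>\<^bsub>R\<^esub>} \<longleftrightarrow> s I \<inter> s J = {}"
  using assms unfolding ideal_support_def by simp

lemma ideal_support_eq_empty_iff:
  assumes "ideal_support R k s" "ideal I R"
  shows "s I = {} \<longleftrightarrow> I = {\<zero>\<^bsub>R\<^esub>}"
  using ideal_support_Int_iff[OF assms(1,2,2)] by simp

lemma ideal_support_surj:
  assumes s: "ideal_support R k s" and "A \<subseteq> {..<k}"
  obtains I where "ideal I R" "s I = A"
proof -
  have "A \<in> s ` {I. ideal I R}"
    using assms unfolding ideal_support_def by simp
  then obtain I where "A = s I" "I \<in> {I. ideal I R}"
    by (rule imageE)
  then show thesis
    using that by simp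
qed

lemma ideal_support_subset:
  assumes "ideal_support R k s" "ideal I R"
  shows "s I \<subseteq> {..<k}"
proof -
  have "s I \<in> s ` {I. ideal I R}"
    using assms(2) by simp
  then show ?thesis
    using assms(1) unfolding ideal_support_def by simp
qed

text \<open>For each point \<open>i\<close> some ideal has support \<open>{i}\<close>. It is
  nonzero, so \<open>E\<close> meets it nontrivially, which puts \<open>i\<close> into the support
  of \<open>E\<close>.\<close>

lemma ideal_support_essential:
  assumes s: "ideal_support R k s" and E: "ideal E R"
    and ess: "\<And>J. ideal J R \<Longrightarrow> E \<inter> J = {\<zero>\<^bsub>R\<^esub>} \<Longrightarrow> J = {\<zero>\<^bsub>R\<^esub>}"
  shows "s E = {..<k}"
proof
  show "s E \<subseteq> {..<k}"
    using ideal_support_subset[OF s E] .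
  show "{..<k} \<subseteq> s E"
  proof
    fix i assume "i \<in> {..<k}"
    then obtain J where J: "ideal J R" "s J = {i}"
      using ideal_support_surj[OF s, of "{i}"] by auto
    then have "E \<inter> J \<noteq> {\<zero>\<^bsub>R\<^esub>}"
      using ess ideal_support_eq_empty_iff[OF s J(1)] by force
    then show "i \<in> s E"
      using ideal_support_Int_iff[OF s E J(1)] J(2) by auto
  qed
qed

lemma sdim_intersection_graph:
  assumes "ring R" and fin: "finite {I. ideal I R}" and k: "0 < k"
    and s: "ideal_support R k s" and ess: "has_proper_essential_ideal R"
  shows "int (sdim (with_proj (intersection_graph R))) =
    int (card {I. ideal I R}) - 2 ^ (k - 1) - 2"
proof -
  interpret ring R by fact
  obtain E where E: "ideal E R" "E \<noteq> carrier R"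
    and E_ess: "\<And>J. ideal J R \<Longrightarrow> E \<inter> J = {\<zero>\<^bsub>R\<^esub>} \<Longrightarrow> J = {\<zero>\<^bsub>R\<^esub>}"
    using ess unfolding has_proper_essential_ideal_def by blast
  have nontriv: "carrier R \<noteq> {\<zero>\<^bsub>R\<^esub>}"
    using E ideal_zero_mem[OF E(1)] ideal_subset_carrier[OF E(1)] by auto
  have E0: "E \<noteq> {\<zero>\<^bsub>R\<^esub>}"
    using E_ess[OF oneideal] nontriv ideal_zero_mem[OF oneideal] by auto
  have V: "nontrivial_ideals R = {I. ideal I R} - {{\<zero>\<^bsub>R\<^esub>}, carrier R}"
    by (auto simp: nontrivial_ideals_def)
  have s_E: "s E = {..<k}"
    using ideal_support_essential[OF s E(1) E_ess] by blast
  \<comment> \<open>The whole ring is essential, since its intersection with any ideal is that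
    ideal.\<close>
  have s_carrier: "s (carrier R) = {..<k}"
    using ideal_support_essential[OF s oneideal] ideal_subset_carrier by (metis Int_absorb1)
  have image: "s ` nontrivial_ideals R = Pow {..<k} - {{}}"
  proof
    show "s ` nontrivial_ideals R \<subseteq> Pow {..<k} - {{}}"
      using ideal_support_subset[OF s] ideal_support_eq_empty_iff[OF s] unfolding V by auto
    show "Pow {..<k} - {{}} \<subseteq> s ` nontrivial_ideals R"
    proof
      fix A assume A: "A \<in> Pow {..<k} - {{}}"
      then obtain I where I: "ideal I R" "s I = A"
        using ideal_support_surj[OF s, of A] by auto
      then have "I \<noteq> {\<zero>\<^bsub>R\<^esub>}"
        using A ideal_support_eq_empty_iff[OF s] by auto
      \<comment> \<open>If the chosen ideal is the whole ring, then \<open>A\<close> is the full set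
        and \<open>E\<close> replaces it.\<close>
      then show "A \<in> s ` nontrivial_ideals R"
        using I E E0 s_E s_carrier unfolding V by (cases "I = carrier R") auto
    qed
  qed
  interpret support_graph "nontrivial_ideals R" s "{..<k}" "intersection_graph R"
  proof
    show "finite (nontrivial_ideals R)"
      using fin by (simp add: V)
    show "parcs (intersection_graph R) = {(u, v). u \<in> nontrivial_ideals R \<and>
        v \<in> nontrivial_ideals R \<and> u \<noteq> v \<and> s u \<inter> s v \<noteq> {}}"
      using ideal_support_Int_iff[OF s] by (auto simp: intersection_graph_def nontrivial_ideals_def)
  qed (use image k in \<open>auto simp: intersection_graph_def lessThan_empty_iff\<close>)
  have "card (nontrivial_ideals R) = card {I. ideal I R} - 2"
    unfolding V using fin nontriv zeroideal oneideal by (subst card_Diff_subset) auto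
  \<comment> \<open>With \<open>card_V_ge\<close>, this makes both natural subtractions exact, so
    that they carry over to the integers.\<close>
  moreover have "2 \<le> card {I. ideal I R}"
    using card_mono[OF fin, of "{{\<zero>\<^bsub>R\<^esub>}, carrier R}"] nontriv zeroideal oneideal by auto
  ultimately show ?thesis
    using sdim_eq card_V_ge by (simp add: of_nat_diff)
qed

section \<open>Isomorphisms and products\<close>

text \<open>The inverse \<open>g\<close> is an isomorphism too, and the image of an ideal under
  \<open>f\<close> is its preimage under \<open>g\<close>. Preimages of ideals under ring
  homomorphisms are ideals.\<close>

lemma ideals_ring_iso:
  assumes "ring R" "ring S" and f: "f \<in> ring_iso R S"
  shows "bij_betw ((`) f) {I. ideal I R} {J. ideal J S}"
proof -
  interpret R: ring R by fact
  interpret S: ring S by fact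
  have bij: "bij_betw f (carrier R) (carrier S)"
    using f by (rule ring_iso_memE(5))
  define g where "g = inv_into (carrier R) f"
  have g: "g \<in> ring_iso S R"
    unfolding g_def using ring_iso_set_sym[OF assms(1) f] .
  interpret f: ring_hom_ring R S f
    using f by (intro ring_hom_ringI2) (auto simp: ring_iso_def R.ring_axioms S.ring_axioms)
  interpret g: ring_hom_ring S R g
    using g by (intro ring_hom_ringI2) (auto simp: ring_iso_def R.ring_axioms S.ring_axioms)
  have gf: "g (f x) = x" if "x \<in> carrier R" for x
    using bij that by (simp add: g_def bij_betw_inv_into_left)
  have fg: "f (g y) = y" if "y \<in> carrier S" for y
    using bij that by (simp add: g_def bij_betw_inv_into_right)
  have inv1: "g ` f ` I = I" if "I \<subseteq> carrier R" for I
  proof -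
    have "(\<lambda>x. g (f x)) ` I = (\<lambda>x. x) ` I"
      using that gf by (intro image_cong) auto
    then show ?thesis
      by (simp add: image_image)
  qed
  have inv2: "f ` g ` J = J" if "J \<subseteq> carrier S" for J
  proof -
    have "(\<lambda>y. f (g y)) ` J = (\<lambda>y. y) ` J"
      using that fg by (intro image_cong) auto
    then show ?thesis
      by (simp add: image_image)
  qed
  show ?thesis
  proof (rule bij_betw_byWitness[where f' = "(`) g"])
    show "\<forall>I\<in>{I. ideal I R}. g ` f ` I = I"
      by (simp add: inv1 ideal_subset_carrier)
    show "\<forall>J\<in>{J. ideal J S}. f ` g ` J = J"
      by (simp add: inv2 ideal_subset_carrier)
    show "(`) f ` {I. ideal I R} \<subseteq> {J. ideal J S}"
    proof safe
      fix I assume I: "ideal I R"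
      have "f ` I = {y \<in> carrier S. g y \<in> I}"
      proof safe
        fix x assume "x \<in> I"
        then show "f x \<in> carrier S" "g (f x) \<in> I"
          using ideal_subset_carrier[OF I] gf by auto
      next
        fix y assume "y \<in> carrier S" "g y \<in> I"
        then show "y \<in> f ` I"
          using fg by (metis imageI)
      qed
      then show "ideal (f ` I) S"
        using g.ideal_vimage[OF I] by simp
    qed
    show "(`) g ` {J. ideal J S} \<subseteq> {I. ideal I R}"
    proof safe
      fix J assume J: "ideal J S"
      have "g ` J = {x \<in> carrier R. f x \<in> J}"
      proof safe
        fix y assume "y \<in> J"
        then show "g y \<in> carrier R" "f (g y) \<in> J"
          using ideal_subset_carrier[OF J] fg by auto
      next
        fix x assume "x \<in> carrier R" "f x \<in> J"
        then show "x \<in> g ` J"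
          using gf by (metis imageI)
      qed
      then show "ideal (g ` J) R"
        using f.ideal_vimage[OF J] by simp
    qed
  qed
qed

lemma ring_iso_image_eq_zero_iff:
  assumes "ring R" "ring S" and f: "f \<in> ring_iso R S" and "A \<subseteq> carrier R"
  shows "f ` A = {\<zero>\<^bsub>S\<^esub>} \<longleftrightarrow> A = {\<zero>\<^bsub>R\<^esub>}"
proof -
  have "f \<zero>\<^bsub>R\<^esub> = \<zero>\<^bsub>S\<^esub>"
    using ring_hom_zero[of f R S] f assms(1,2) by (simp add: ring_iso_def)
  then have "f ` {\<zero>\<^bsub>R\<^esub>} = {\<zero>\<^bsub>S\<^esub>}"
    by simp
  moreover have "inj_on f (carrier R)"
    using ring_iso_memE(5)[OF f] by (rule bij_betw_imp_inj_on)
  ultimately show ?thesis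
    using inj_on_image_eq_iff[of f "carrier R" A "{\<zero>\<^bsub>R\<^esub>}"] assms(1,4)
    by (metis empty_subsetI insert_subset ring.ring_simprules(2))
qed

lemma ring_iso_image_Int:
  assumes f: "f \<in> ring_iso R S" and "ideal I R" "ideal J R"
  shows "f ` (I \<inter> J) = f ` I \<inter> f ` J"
  using bij_betw_imp_inj_on[OF ring_iso_memE(5)[OF f]] assms(2,3)
  by (intro inj_on_image_Int) (auto dest: ideal_subset_carrier)

lemma ring_iso_Int_eq_zero_iff:
  assumes "ring R" "ring S" and f: "f \<in> ring_iso R S" and "ideal I R" "ideal J R"
  shows "f ` I \<inter> f ` J = {\<zero>\<^bsub>S\<^esub>} \<longleftrightarrow> I \<inter> J = {\<zero>\<^bsub>R\<^esub>}"
  using ring_iso_image_eq_zero_iff[OF assms(1,2) f, of "I \<inter> J"] assms(4,5)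
  by (metis ring_iso_image_Int[OF f] ideal_subset_carrier inf.coboundedI1)

lemma ideal_support_ring_iso:
  assumes "ring R" "ring S" and f: "f \<in> ring_iso R S" and s: "ideal_support S k s"
  shows "ideal_support R k (\<lambda>I. s (f ` I))"
proof -
  have bij: "(`) f ` {I. ideal I R} = {J. ideal J S}"
    using ideals_ring_iso[OF assms(1-3)] by (rule bij_betw_imp_surj_on)
  then have "(\<lambda>I. s (f ` I)) ` {I. ideal I R} = Pow {..<k}"
    using s unfolding ideal_support_def by (metis image_image)
  moreover have "ideal (f ` I) S" if "ideal I R" for I
    using bij that by blast
  ultimately show ?thesis
    using s ring_iso_Int_eq_zero_iff[OF assms(1-3)] unfolding ideal_support_def by simp
qed

lemma has_proper_essential_ideal_ring_iso:
  assumes "ring R" "ring S" and f: "f \<in> ring_iso R S" and ess: "has_proper_essential_ideal R"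
  shows "has_proper_essential_ideal S"
proof -
  have bij: "(`) f ` {I. ideal I R} = {J. ideal J S}"
    using ideals_ring_iso[OF assms(1-3)] by (rule bij_betw_imp_surj_on)
  obtain E where E: "ideal E R" "E \<noteq> carrier R"
    and E_ess: "\<And>J. ideal J R \<Longrightarrow> E \<inter> J = {\<zero>\<^bsub>R\<^esub>} \<Longrightarrow> J = {\<zero>\<^bsub>R\<^esub>}"
    using ess unfolding has_proper_essential_ideal_def by blast
  have "f ` E \<noteq> f ` carrier R"
    using E ideal_subset_carrier bij_betw_imp_inj_on[OF ring_iso_memE(5)[OF f]]
    by (metis inj_on_image_eq_iff subset_refl)
  then have "f ` E \<noteq> carrier S"
    using bij_betw_imp_surj_on[OF ring_iso_memE(5)[OF f]] by simp
  moreover have "J = {\<zero>\<^bsub>S\<^esub>}" if J: "ideal J S" "f ` E \<inter> J = {\<zero>\<^bsub>S\<^esub>}" for J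
  proof -
    obtain I where I: "ideal I R" "J = f ` I"
      using bij J(1) by blast
    then have "I = {\<zero>\<^bsub>R\<^esub>}"
      using E_ess J(2) ring_iso_Int_eq_zero_iff[OF assms(1-3) E(1)] by simp
    then show ?thesis
      using I ideal_subset_carrier ring_iso_image_eq_zero_iff[OF assms(1-3)] by metis
  qed
  ultimately show ?thesis
    using E(1) bij unfolding has_proper_essential_ideal_def by blast
qed

section \<open>Ideals of a product of two rings\<close>

lemma RDirProd_ops:
  "\<zero>\<^bsub>RDirProd R S\<^esub> = (\<zero>\<^bsub>R\<^esub>, \<zero>\<^bsub>S\<^esub>)"
  "x \<oplus>\<^bsub>RDirProd R S\<^esub> y = (fst x \<oplus>\<^bsub>R\<^esub> fst y, snd x \<oplus>\<^bsub>S\<^esub> snd y)"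
  "x \<otimes>\<^bsub>RDirProd R S\<^esub> y = (fst x \<otimes>\<^bsub>R\<^esub> fst y, snd x \<otimes>\<^bsub>S\<^esub> snd y)"
  by (cases x; cases y; simp add: RDirProd_def DirProd_def monoid.defs)+

lemma fst_ring_hom: "fst \<in> ring_hom (RDirProd R S) R"
  and snd_ring_hom: "snd \<in> ring_hom (RDirProd R S) S"
  by (auto simp: ring_hom_def RDirProd_def DirProd_def monoid.defs)

text \<open>Multiplying by the idempotents (1, 0) and (0, 1) maps an ideal \<open>K\<close> into
  itself, so with (x, y) it contains (x, 0) and (0, y). Therefore \<open>K\<close> is the product of
  its two projections.\<close>

lemma ideals_RDirProd:
  assumes "ring R" "ring S"
  shows "bij_betw (\<lambda>(I, J). I \<times> J) ({I. ideal I R} \<times> {J. ideal J S}) {K. ideal K (RDirProd R S)}"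
    (is "bij_betw ?t ?A ?B")
proof -
  interpret R: ring R by fact
  interpret S: ring S by fact
  interpret P: ring "RDirProd R S" using RDirProd_ring[OF assms] .
  interpret p1: ring_hom_ring "RDirProd R S" R fst
    by (intro ring_hom_ringI2 fst_ring_hom P.ring_axioms R.ring_axioms)
  interpret p2: ring_hom_ring "RDirProd R S" S snd
    by (intro ring_hom_ringI2 snd_ring_hom P.ring_axioms S.ring_axioms)
  have inj: "inj_on ?t ?A"
  proof (rule inj_on_inverseI)
    fix x assume "x \<in> ?A"
    then obtain I J where x: "x = (I, J)" "ideal I R" "ideal J S"
      by blast
    \<comment> \<open>Only for nonempty factors do the projections recover them from the
      product.\<close>
    then have "I \<noteq> {}" "J \<noteq> {}"
      using ideal_zero_mem[of I R] ideal_zero_mem[of J S] by auto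
    then show "(\<lambda>K. (fst ` K, snd ` K)) (?t x) = x"
      by (simp add: x(1))
  qed
  have prod: "ideal (I \<times> J) (RDirProd R S)" if I: "ideal I R" and J: "ideal J S" for I J
  proof -
    \<comment> \<open>A product of ideals is the intersection of the preimages of its factors under
      the two projections.\<close>
    have "I \<times> J = {x \<in> carrier (RDirProd R S). fst x \<in> I} \<inter>
        {x \<in> carrier (RDirProd R S). snd x \<in> J}"
      using ideal_subset_carrier[OF I] ideal_subset_carrier[OF J] by (auto simp: RDirProd_carrier)
    then show ?thesis
      using P.i_intersect[OF p1.ideal_vimage[OF I] p2.ideal_vimage[OF J]] by simp
  qed
  have "K \<in> ?t ` ?A" if K: "ideal K (RDirProd R S)" for K
  proof -
    interpret K: ideal K "RDirProd R S" by fact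
    have sub: "fst x \<in> carrier R" "snd x \<in> carrier S" if "x \<in> K" for x
      using K.Icarr[OF that] by (auto simp: RDirProd_carrier)
    have left: "(x, \<zero>\<^bsub>S\<^esub>) \<in> K" if "(x, y) \<in> K" for x y
      using K.I_l_closed[OF that, of "(\<one>\<^bsub>R\<^esub>, \<zero>\<^bsub>S\<^esub>)"] sub[OF that]
      by (simp add: RDirProd_ops RDirProd_carrier)
    have right: "(\<zero>\<^bsub>R\<^esub>, y) \<in> K" if "(x, y) \<in> K" for x y
      using K.I_l_closed[OF that, of "(\<zero>\<^bsub>R\<^esub>, \<one>\<^bsub>S\<^esub>)"] sub[OF that]
      by (simp add: RDirProd_ops RDirProd_carrier)
    have both: "(x, y) \<in> K" if "(x, \<zero>\<^bsub>S\<^esub>) \<in> K" "(\<zero>\<^bsub>R\<^esub>, y) \<in> K" for x y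
      using K.a_closed[OF that] sub[OF that(1)] sub[OF that(2)] by (simp add: RDirProd_ops)
    have i1: "(\<lambda>x. (x, \<zero>\<^bsub>S\<^esub>)) ` (fst ` K) \<subseteq> K" and i2: "(\<lambda>y. (\<zero>\<^bsub>R\<^esub>, y)) ` (snd ` K) \<subseteq> K"
      using left right by auto
    have "K = fst ` K \<times> snd ` K"
    proof
      show "fst ` K \<times> snd ` K \<subseteq> K"
      proof (rule subrelI)
        fix x y assume "(x, y) \<in> fst ` K \<times> snd ` K"
        then have "(x, \<zero>\<^bsub>S\<^esub>) \<in> K" "(\<zero>\<^bsub>R\<^esub>, y) \<in> K"
          using i1 i2 by auto
        then show "(x, y) \<in> K"
          by (rule both)
      qed
    qed (rule subset_fst_snd)
    moreover have "ideal (fst ` K) R"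
    proof (rule idealI[OF assms(1)])
      show "subgroup (fst ` K) (add_monoid R)"
        using K.a_subgroup p1.a_group_hom
        by (metis group_hom.subgroup_img_is_subgroup abelian_group_hom.a_group_hom p1.abelian_group_hom_axioms)
      fix a x assume "a \<in> fst ` K" and x: "x \<in> carrier R"
      then have "(a, \<zero>\<^bsub>S\<^esub>) \<in> K" "(x, \<zero>\<^bsub>S\<^esub>) \<in> carrier (RDirProd R S)"
        using i1 by (auto simp: RDirProd_carrier)
      from K.I_l_closed[OF this] K.I_r_closed[OF this]
      show "x \<otimes>\<^bsub>R\<^esub> a \<in> fst ` K" "a \<otimes>\<^bsub>R\<^esub> x \<in> fst ` K"
        by (force simp: RDirProd_ops)+
    qed
    moreover have "ideal (snd ` K) S"
    proof (rule idealI[OF assms(2)])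
      show "subgroup (snd ` K) (add_monoid S)"
        using K.a_subgroup p2.a_group_hom
        by (metis group_hom.subgroup_img_is_subgroup abelian_group_hom.a_group_hom p2.abelian_group_hom_axioms)
      fix a x assume "a \<in> snd ` K" and x: "x \<in> carrier S"
      then have "(\<zero>\<^bsub>R\<^esub>, a) \<in> K" "(\<zero>\<^bsub>R\<^esub>, x) \<in> carrier (RDirProd R S)"
        using i2 by (auto simp: RDirProd_carrier)
      from K.I_l_closed[OF this] K.I_r_closed[OF this]
      show "x \<otimes>\<^bsub>S\<^esub> a \<in> snd ` K" "a \<otimes>\<^bsub>S\<^esub> x \<in> snd ` K"
        by (force simp: RDirProd_ops)+
    qed
    ultimately show ?thesis
      by blast
  qed
  then have "?t ` ?A = ?B"
    using prod by auto
  with inj show ?thesis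
    by (rule bij_betw_imageI)
qed

lemma ideal_RDirProdI:
  assumes "ideal I R" "ideal J S"
  shows "ideal (I \<times> J) (RDirProd R S)"
  using bij_betwE[OF ideals_RDirProd[OF ideal.axioms(2)[OF assms(1)] ideal.axioms(2)[OF assms(2)]]]
    assms by auto

lemma ideal_RDirProdE:
  assumes "ring R" "ring S" and K: "ideal K (RDirProd R S)"
  obtains I J where "ideal I R" "ideal J S" "K = I \<times> J"
proof -
  have "K \<in> (\<lambda>(I, J). I \<times> J) ` ({I. ideal I R} \<times> {J. ideal J S})"
    using K bij_betw_imp_surj_on[OF ideals_RDirProd[OF assms(1,2)]] by simp
  then show thesis
    using that by blast
qed

lemma RDirProd_Int_eq_zero_iff:
  assumes "ideal I R" "ideal I' R" "ideal J S" "ideal J' S"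
  shows "(I \<times> J) \<inter> (I' \<times> J') = {\<zero>\<^bsub>RDirProd R S\<^esub>} \<longleftrightarrow>
    I \<inter> I' = {\<zero>\<^bsub>R\<^esub>} \<and> J \<inter> J' = {\<zero>\<^bsub>S\<^esub>}"
proof -
  have "(I \<times> J) \<inter> (I' \<times> J') = (I \<inter> I') \<times> (J \<inter> J')"
    by blast
  moreover have "{\<zero>\<^bsub>RDirProd R S\<^esub>} = {\<zero>\<^bsub>R\<^esub>} \<times> {\<zero>\<^bsub>S\<^esub>}"
    by (simp add: RDirProd_ops)
  ultimately show ?thesis
    using assms[THEN ideal_zero_mem] by (auto simp: times_eq_iff)
qed

text \<open>The support of I \<times> J is the disjoint union of the supports of its factors: that
  of \<open>I\<close> stays below \<open>k\<close>, that of \<open>J\<close> is shifted by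
  \<open>k\<close>.\<close>

lemma ideal_support_RDirProd:
  assumes "ring R" "ring S" and s: "ideal_support R k s" and t: "ideal_support S l t"
  shows "\<exists>u. ideal_support (RDirProd R S) (k + l) u"
proof -
  define u where "u K = s (fst ` K) \<union> (+) k ` t (snd ` K)" for K
  have u: "u (I \<times> J) = s I \<union> (+) k ` t J" if "ideal I R" "ideal J S" for I J
  proof -
    have "I \<noteq> {}" "J \<noteq> {}"
      using ideal_zero_mem[OF that(1)] ideal_zero_mem[OF that(2)] by auto
    then show ?thesis
      by (simp add: u_def)
  qed
  have s_sub: "s I \<subseteq> {..<k}" if "ideal I R" for I
    using ideal_support_subset[OF s that] .
  have t_sub: "t J \<subseteq> {..<l}" if "ideal J S" for J
    using ideal_support_subset[OF t that] .
  have "u ` {K. ideal K (RDirProd R S)} = Pow {..<k + l}"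
  proof
    show "u ` {K. ideal K (RDirProd R S)} \<subseteq> Pow {..<k + l}"
    proof (rule image_subsetI)
      fix K assume "K \<in> {K. ideal K (RDirProd R S)}"
      then obtain I J where IJ: "ideal I R" "ideal J S" "K = I \<times> J"
        using ideal_RDirProdE[OF assms(1,2)] by blast
      then show "u K \<in> Pow {..<k + l}"
        using u s_sub[OF IJ(1)] t_sub[OF IJ(2)] by auto
    qed
    show "Pow {..<k + l} \<subseteq> u ` {K. ideal K (RDirProd R S)}"
    proof
      fix A assume A: "A \<in> Pow {..<k + l}"
      obtain I where I: "ideal I R" "s I = A \<inter> {..<k}"
        using ideal_support_surj[OF s, of "A \<inter> {..<k}"] by auto
      have "{j. k + j \<in> A} \<subseteq> {..<l}"
        using A by auto
      then obtain J where J: "ideal J S" "t J = {j. k + j \<in> A}"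
        by (rule ideal_support_surj[OF t])
      have "A = (A \<inter> {..<k}) \<union> (+) k ` {j. k + j \<in> A}"
        by (auto simp: image_iff) (metis le_add_diff_inverse not_less)
      then have "u (I \<times> J) = A"
        using u I J by simp
      moreover have "ideal (I \<times> J) (RDirProd R S)"
        using I(1) J(1) by (rule ideal_RDirProdI)
      ultimately show "A \<in> u ` {K. ideal K (RDirProd R S)}"
        by blast
    qed
  qed
  moreover have "K \<inter> K' = {\<zero>\<^bsub>RDirProd R S\<^esub>} \<longleftrightarrow> u K \<inter> u K' = {}"
    if K: "ideal K (RDirProd R S)" and K': "ideal K' (RDirProd R S)" for K K'
  proof -
    obtain I J where IJ: "ideal I R" "ideal J S" "K = I \<times> J"
      using ideal_RDirProdE[OF assms(1,2) K] .
    obtain I' J' where IJ': "ideal I' R" "ideal J' S" "K' = I' \<times> J'"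
      using ideal_RDirProdE[OF assms(1,2) K'] .
    \<comment> \<open>The mixed intersections vanish, because the first parts lie below
      \<open>k\<close> and the shifted parts do not.\<close>
    have "u K \<inter> u K' = (s I \<inter> s I') \<union> (+) k ` (t J \<inter> t J')"
      using u IJ IJ' s_sub[OF IJ(1)] s_sub[OF IJ'(1)] by fastforce
    then show ?thesis
      using ideal_support_Int_iff[OF s IJ(1) IJ'(1)] ideal_support_Int_iff[OF t IJ(2) IJ'(2)]
        RDirProd_Int_eq_zero_iff[OF IJ(1) IJ'(1) IJ(2) IJ'(2)]
      by (simp add: IJ(3) IJ'(3))
  qed
  ultimately show ?thesis
    unfolding ideal_support_def by blast
qed

text \<open>One factor with a proper essential ideal \<open>E\<close> suffices: the product of
  \<open>E\<close> with all of \<open>S\<close> is proper and essential.\<close>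

lemma has_proper_essential_ideal_RDirProd:
  assumes "ring R" "ring S" and ess: "has_proper_essential_ideal R"
  shows "has_proper_essential_ideal (RDirProd R S)"
proof -
  have S: "ideal (carrier S) S"
    using assms(2) by (rule ring.oneideal)
  obtain E where E: "ideal E R" "E \<noteq> carrier R"
    and E_ess: "\<And>J. ideal J R \<Longrightarrow> E \<inter> J = {\<zero>\<^bsub>R\<^esub>} \<Longrightarrow> J = {\<zero>\<^bsub>R\<^esub>}"
    using ess unfolding has_proper_essential_ideal_def by blast
  have "ideal (E \<times> carrier S) (RDirProd R S)"
    using ideal_RDirProdI E(1) S .
  moreover have "E \<times> carrier S \<noteq> carrier (RDirProd R S)"
    using E ideal_zero_mem[OF S] by (auto simp: RDirProd_carrier times_eq_iff)
  moreover have "K = {\<zero>\<^bsub>RDirProd R S\<^esub>}"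
    if K: "ideal K (RDirProd R S)" "(E \<times> carrier S) \<inter> K = {\<zero>\<^bsub>RDirProd R S\<^esub>}" for K
  proof -
    obtain I J where IJ: "ideal I R" "ideal J S" "K = I \<times> J"
      using ideal_RDirProdE[OF assms(1,2) K(1)] .
    then have "E \<inter> I = {\<zero>\<^bsub>R\<^esub>}" "carrier S \<inter> J = {\<zero>\<^bsub>S\<^esub>}"
      using K(2) RDirProd_Int_eq_zero_iff[OF E(1) IJ(1) S IJ(2)] by auto
    then show ?thesis
      using E_ess[OF IJ(1)] ideal_subset_carrier[OF IJ(2)] IJ(3)
      by (simp add: RDirProd_ops Int_absorb1)
  qed
  ultimately show ?thesis
    unfolding has_proper_essential_ideal_def by blast
qed

section \<open>Numbers of ideals, and products of lists of rings\<close>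

lemma card_ideals_ring_iso:
  assumes "ring R" "ring S" "f \<in> ring_iso R S"
  shows "finite {I. ideal I R} \<longleftrightarrow> finite {J. ideal J S}"
    and "card {I. ideal I R} = card {J. ideal J S}"
  using ideals_ring_iso[OF assms] by (auto dest: bij_betw_finite bij_betw_same_card)

lemma card_ideals_RDirProd:
  assumes "ring R" "ring S"
  shows "finite {I. ideal I R} \<Longrightarrow> finite {J. ideal J S} \<Longrightarrow> finite {K. ideal K (RDirProd R S)}"
    and "card {K. ideal K (RDirProd R S)} = card {I. ideal I R} * card {J. ideal J S}"
  using ideals_RDirProd[OF assms]
  by (auto dest: bij_betw_finite bij_betw_same_card simp: card_cartesian_product)

lemma ideals_nil_ring: "{I. ideal I (nil_ring :: 'a list ring)} = {{[]}}"
proof -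
  interpret ring "nil_ring :: 'a list ring"
    using RDirProd_list_is_ring[of "[]"] by simp
  have "I = {[]}" if "ideal I (nil_ring :: 'a list ring)" for I
    using ideal_zero_mem[OF that] ideal_subset_carrier[OF that] by auto
  then show ?thesis
    using oneideal by auto
qed

text \<open>Induction on the list, starting from the one-element ring with no points. The product
  over a nonempty list is only isomorphic to the binary product of head and tail, so every property
  is transported along \<open>RDirProd_list_iso2\<close>.\<close>

lemma ideals_RDirProd_list:
  assumes "\<And>R. R \<in> set Rs \<Longrightarrow> ring R" "\<And>R. R \<in> set Rs \<Longrightarrow> finite {I. ideal I R}"
    and "\<And>R. R \<in> set Rs \<Longrightarrow> \<exists>s. ideal_support R 1 s"
  shows "finite {I. ideal I (RDirProd_list Rs)} \<and>
    card {I. ideal I (RDirProd_list Rs)} = (\<Prod>R\<leftarrow>Rs. card {I. ideal I R}) \<and>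
    (\<exists>s. ideal_support (RDirProd_list Rs) (length Rs) s)"
  using assms
proof (induction Rs)
  case Nil
  have "I \<inter> J = {\<zero>\<^bsub>nil_ring\<^esub>}" if "ideal I nil_ring" "ideal J nil_ring" for I J :: "'a list set"
    using that[THEN ideal_zero_mem] that[THEN ideal_subset_carrier] by (auto simp: monoid.defs)
  then have "ideal_support (nil_ring :: 'a list ring) 0 (\<lambda>_. {})"
    unfolding ideal_support_def ideals_nil_ring by simp
  then show ?case
    unfolding RDirProd_list_nil ideals_nil_ring by auto
next
  case (Cons R Rs)
  have R: "ring R" "finite {I. ideal I R}"
    using Cons.prems by simp_all
  have L: "ring (RDirProd_list Rs)" "ring (RDirProd_list (R # Rs))"
    using Cons.prems(1) by (metis RDirProd_list_is_ring nth_mem list.set_intros(2))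
      (metis Cons.prems(1) RDirProd_list_is_ring nth_mem)
  note P = RDirProd_ring[OF R(1) L(1)]
  have IH: "finite {I. ideal I (RDirProd_list Rs)}"
    "card {I. ideal I (RDirProd_list Rs)} = (\<Prod>R\<leftarrow>Rs. card {I. ideal I R})"
    "\<exists>s. ideal_support (RDirProd_list Rs) (length Rs) s"
    using Cons.IH Cons.prems by auto
  obtain s where "ideal_support R 1 s"
    using Cons.prems(3) by auto
  then obtain u where "ideal_support (RDirProd R (RDirProd_list Rs)) (1 + length Rs) u"
    using IH(3) ideal_support_RDirProd[OF R(1) L(1)] by blast
  then have "\<exists>s. ideal_support (RDirProd_list (R # Rs)) (length (R # Rs)) s"
    using ideal_support_ring_iso[OF L(2) P RDirProd_list_iso2] by auto
  then show ?case
    using card_ideals_RDirProd[OF R(1) L(1)] card_ideals_ring_iso[OF L(2) P RDirProd_list_iso2] R IH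
    by simp
qed

section \<open>The factors\<close>

text \<open>When any two nonzero ideals meet nontrivially, a single point is enough: it records
  whether the ideal is nonzero.\<close>

lemma ideal_support_one:
  assumes "ring R" "carrier R \<noteq> {\<zero>\<^bsub>R\<^esub>}"
    and uniform: "\<And>I J. ideal I R \<Longrightarrow> ideal J R \<Longrightarrow> I \<inter> J = {\<zero>\<^bsub>R\<^esub>} \<Longrightarrow> I = {\<zero>\<^bsub>R\<^esub>} \<or> J = {\<zero>\<^bsub>R\<^esub>}"
  shows "\<exists>s. ideal_support R 1 s"
proof -
  interpret ring R by fact
  let ?s = "\<lambda>I. if I = {\<zero>\<^bsub>R\<^esub>} then {} else {0::nat}"
  have "?s ` {I. ideal I R} = Pow {..<1}"
  proof
    show "Pow {..<1} \<subseteq> ?s ` {I. ideal I R}"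
      using zeroideal oneideal assms(2) by (auto simp: lessThan_Suc image_iff subset_singleton_iff)
  qed auto
  moreover have "I \<inter> J = {\<zero>\<^bsub>R\<^esub>} \<longleftrightarrow> ?s I \<inter> ?s J = {}" if "ideal I R" "ideal J R" for I J
    using uniform[OF that] that[THEN ideal_zero_mem] by auto
  ultimately have "ideal_support R 1 ?s"
    unfolding ideal_support_def by blast
  then show ?thesis
    by blast
qed

section \<open>Fields, and local principal ideal rings with finitely many ideals\<close>

lemma (in domain) carrier_nontrivial: "carrier R \<noteq> {\<zero>}"
  using one_not_zero one_closed by (metis singletonD)

lemma (in field) ideal_support_field: "\<exists>s. ideal_support R 1 s"
  using all_ideals by (intro ideal_support_one[OF ring_axioms carrier_nontrivial]) blast

lemma (in field) card_ideals: "card {I. ideal I R} = 2"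
  using carrier_nontrivial by (subst all_ideals) auto

text \<open>The principal ideal of a nonunit is proper. As there are finitely many ideals, it lies
  in a maximal one among the proper ideals, without an appeal to Zorn's lemma, and that ideal must
  be \<open>M\<close>.\<close>

lemma (in cring) nonunit_in_maximalideal:
  assumes fin: "finite {I. ideal I R}" and M: "\<And>N. maximalideal N R \<Longrightarrow> N = M"
    and u: "u \<in> carrier R" "u \<notin> Units R"
  shows "u \<in> M"
proof -
  let ?P = "{J. ideal J R \<and> J \<noteq> carrier R}"
  have "\<one> \<notin> PIdl u"
  proof
    assume "\<one> \<in> PIdl u"
    then obtain x where "x \<in> carrier R" "\<one> = x \<otimes> u"
      unfolding cgenideal_def by blast
    then show False
      using u by (auto simp: Units_def m_comm)
  qed
  then have "PIdl u \<in> ?P"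
    using cgenideal_ideal[OF u(1)] by auto
  moreover have "finite ?P"
    using fin by (rule rev_finite_subset) auto
  ultimately obtain N where N: "N \<in> ?P" "PIdl u \<subseteq> N" and max: "\<forall>J\<in>?P. N \<subseteq> J \<longrightarrow> N = J"
    using finite_has_maximal2[of ?P "PIdl u"] by blast
  have "maximalideal N R"
    using N max by (intro maximalidealI) auto
  then show ?thesis
    using M N(2) cgenideal_self[OF u(1)] by blast
qed

text \<open>Let \<open>p\<close> generate the maximal ideal. It is nilpotent, and every nonzero
  element is a power of \<open>p\<close> times a unit. Hence every nonzero ideal contains a nonzero
  power of \<open>p\<close>, and so the last nonzero power, which is \<open>z\<close>.\<close>

lemma local_pir_common_element:
  fixes R (structure)
  assumes "local_ring R" "principal_ideal_ring R" and fin: "finite {I. ideal I R}"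
  shows "\<exists>z \<in> carrier R. z \<noteq> \<zero> \<and> (\<forall>I. ideal I R \<longrightarrow> I \<noteq> {\<zero>} \<longrightarrow> z \<in> I)"
proof -
  interpret cring R
    using assms(1) by (simp add: local_ring_def)
  obtain M where M: "maximalideal M R" "\<And>N. maximalideal N R \<Longrightarrow> N = M"
    using assms(1) unfolding local_ring_def by blast
  interpret M: maximalideal M R by fact
  have one_notin: "\<one> \<notin> M"
    using M.I_notcarr M.one_imp_carrier by blast
  have unit: "u \<in> Units R" if "u \<in> carrier R" "u \<notin> M" for u
    using nonunit_in_maximalideal[OF fin M(2)] that by blast
  have "principalideal M R"
    using assms(2) M.is_ideal unfolding principal_ideal_ring_def by blast
  then obtain p where p: "p \<in> carrier R" "M = PIdl p"
    using principalideal.generate cgenideal_eq_genideal by metis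
  have nilpotent: "\<exists>k. p [^] (k::nat) = \<zero>"
  proof -
    \<comment> \<open>Two different powers of \<open>p\<close> generate the same ideal, as there are
      only finitely many ideals.\<close>
    have "\<not> inj (\<lambda>k::nat. PIdl (p [^] k))"
    proof
      assume "inj (\<lambda>k::nat. PIdl (p [^] k))"
      then have "infinite (range (\<lambda>k::nat. PIdl (p [^] k)))"
        using finite_imageD by blast
      moreover have "range (\<lambda>k::nat. PIdl (p [^] k)) \<subseteq> {I. ideal I R}"
        using cgenideal_ideal p by auto
      ultimately show False
        using fin finite_subset by blast
    qed
    then obtain k l :: nat where kl: "k < l" "PIdl (p [^] k) = PIdl (p [^] l)"
      unfolding inj_def by (metis nat_neq_iff)
    then have "p [^] k \<in> PIdl (p [^] l)"
      using cgenideal_self[of "p [^] k"] p by simp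
    then obtain r where r: "r \<in> carrier R" "p [^] k = r \<otimes> p [^] l"
      unfolding cgenideal_def by blast
    \<comment> \<open>Chosen so that r p^l = q p^k; the factor \<open>p\<close> split off, available
      since k < l, puts \<open>q\<close> into \<open>M\<close>. Then 1 - q is a unit that
      annihilates p^k, as in Nakayama's lemma.\<close>
    define q where "q = r \<otimes> p [^] (l - Suc k) \<otimes> p"
    have q: "q \<in> carrier R"
      using r p by (simp add: q_def)
    have "q \<in> M"
      unfolding q_def p(2) cgenideal_def using r p by auto
    have "p [^] l = p [^] (l - Suc k) \<otimes> p \<otimes> p [^] k"
      using nat_pow_mult[OF p(1), of "Suc (l - Suc k)" k] kl(1) by simp
    then have eq: "p [^] k = q \<otimes> p [^] k"
      using r p by (simp add: q_def m_assoc)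
    have "(\<one> \<ominus> q) \<otimes> p [^] k = p [^] k \<ominus> q \<otimes> p [^] k"
      using q p by (simp add: minus_eq l_distr l_minus)
    also have "\<dots> = \<zero>"
      using eq p by (metis minus_eq r_neg nat_pow_closed)
    finally have zero: "(\<one> \<ominus> q) \<otimes> p [^] k = \<zero>" .
    have "\<one> \<ominus> q \<notin> M"
    proof
      assume "\<one> \<ominus> q \<in> M"
      then have "(\<one> \<ominus> q) \<oplus> q \<in> M"
        using \<open>q \<in> M\<close> by (rule M.a_closed)
      moreover have "(\<one> \<ominus> q) \<oplus> q = \<one>"
        using q by (simp add: minus_eq a_assoc l_neg)
      ultimately show False
        using one_notin by simp
    qed
    then have "\<one> \<ominus> q \<in> Units R"
      using unit q by simp
    then have "p [^] k = \<zero>"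
      using zero p by (metis Units_l_cancel Units_closed nat_pow_closed r_null zero_closed)
    then show ?thesis
      by blast
  qed
  define N where "N = (LEAST k::nat. p [^] k = \<zero>)"
  have N: "p [^] N = \<zero>" and N_least: "\<And>k::nat. k < N \<Longrightarrow> p [^] k \<noteq> \<zero>"
    using nilpotent unfolding N_def by (auto intro: LeastI dest: not_less_Least)
  have "\<one> \<noteq> \<zero>"
    using one_notin M.zero_closed by auto
  \<comment> \<open>Hence \<open>N - 1\<close> is a true predecessor, and p^(N - 1) is the last
    nonzero power.\<close>
  then have "0 < N"
    using N by (metis gr0I nat_pow_0)
  define z where "z = p [^] (N - 1)"
  have "z \<in> I" if I: "ideal I R" "I \<noteq> {\<zero>}" for I
  proof -
    obtain a where a: "a \<in> I" "a \<noteq> \<zero>"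
      using I ideal_zero_mem[OF I(1)] by blast
    have ac: "a \<in> carrier R"
      using a(1) ideal_subset_carrier[OF I(1)] by blast
    \<comment> \<open>The exponents of the powers of \<open>p\<close> that divide \<open>a\<close>.
      They are below \<open>N\<close> because \<open>a\<close> is nonzero, so a largest one
      exists.\<close>
    let ?D = "{j::nat. \<exists>c \<in> carrier R. a = p [^] j \<otimes> c}"
    have D: "j < N" if "j \<in> ?D" for j
    proof (rule ccontr)
      assume "\<not> j < N"
      then have "p [^] j = p [^] N \<otimes> p [^] (j - N)"
        using p by (simp add: nat_pow_mult)
      then have "p [^] j = \<zero>"
        using N p by simp
      then show False
        using that a by auto
    qed
    have "0 \<in> ?D"
      using ac by auto
    moreover have "finite ?D"
      using D by (meson finite_nat_set_iff_bounded)
    ultimately have max: "Max ?D \<in> ?D" "\<And>j. j \<in> ?D \<Longrightarrow> j \<le> Max ?D"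
      using Max_in[of ?D] Max_ge[of ?D] by blast+
    define j where "j = Max ?D"
    obtain c where c: "c \<in> carrier R" "a = p [^] j \<otimes> c"
      using max(1) unfolding j_def by blast
    \<comment> \<open>Otherwise \<open>c\<close> is a multiple of \<open>p\<close>, and a larger
      power of \<open>p\<close> divides \<open>a\<close>.\<close>
    have "c \<notin> M"
    proof
      assume "c \<in> M"
      then obtain b where b: "b \<in> carrier R" "c = b \<otimes> p"
        unfolding p(2) cgenideal_def by blast
      then have "a = p [^] Suc j \<otimes> b"
        using c p by (simp add: m_ac)
      then have "Suc j \<in> ?D"
        using b by blast
      then show False
        using max(2) unfolding j_def by fastforce
    qed
    then have c_unit: "c \<in> Units R"
      using unit c by blast
    have "j < N"
      using D max(1) unfolding j_def by blast
    have "p [^] j = a \<otimes> inv c"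
      using c c_unit p by (simp add: m_assoc)
    then have "p [^] j \<in> I"
      using ideal.I_r_closed[OF I(1) a(1)] c_unit by simp
    \<comment> \<open>Since j < N, multiplying by the missing power of \<open>p\<close> leads from
      p^j to \<open>z\<close>.\<close>
    then have "p [^] (N - 1 - j) \<otimes> p [^] j \<in> I"
      using ideal.I_l_closed[OF I(1)] p by simp
    then show ?thesis
      using \<open>j < N\<close> p by (simp add: z_def nat_pow_mult)
  qed
  moreover have "z \<noteq> \<zero>"
    using N_least \<open>0 < N\<close> by (simp add: z_def)
  ultimately show ?thesis
    using p by (auto simp: z_def)
qed

lemma local_ring_carrier_nontrivial:
  assumes "local_ring R"
  shows "carrier R \<noteq> {\<zero>\<^bsub>R\<^esub>}"
proof -
  obtain M where "maximalideal M R"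
    using assms unfolding local_ring_def by blast
  then interpret maximalideal M R .
  show ?thesis
    using I_notcarr zero_closed a_subset by auto
qed

lemma ideal_support_local_pir:
  assumes "local_ring R" "principal_ideal_ring R" "finite {I. ideal I R}"
  shows "\<exists>s. ideal_support R 1 s"
proof (rule ideal_support_one[OF _ local_ring_carrier_nontrivial[OF assms(1)]])
  show "ring R"
    using assms(1) by (simp add: local_ring_def cring.axioms(1))
  show "I = {\<zero>\<^bsub>R\<^esub>} \<or> J = {\<zero>\<^bsub>R\<^esub>}"
    if "ideal I R" "ideal J R" "I \<inter> J = {\<zero>\<^bsub>R\<^esub>}" for I J
    using local_pir_common_element[OF assms] that by blast
qed

text \<open>The maximal ideal is nonzero because the ring is not a field. It therefore contains the
  element common to all nonzero ideals and meets each of them nontrivially.\<close>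

lemma has_proper_essential_ideal_local_pir:
  assumes "local_ring R" "principal_ideal_ring R" "finite {I. ideal I R}" "\<not> field R"
  shows "has_proper_essential_ideal R"
proof -
  interpret cring R
    using assms(1) by (simp add: local_ring_def)
  obtain M where M: "maximalideal M R"
    using assms(1) unfolding local_ring_def by blast
  then have "M \<noteq> {\<zero>\<^bsub>R\<^esub>}"
    using assms(4) zeromaximalideal_fieldI by blast
  moreover have "ideal M R" "M \<noteq> carrier R"
    using M maximalideal.I_notcarr maximalideal.axioms(1) by blast+
  ultimately show ?thesis
    using local_pir_common_element[OF assms(1-3)] unfolding has_proper_essential_ideal_def by blast
qed

section \<open>Ideal counts of the factors and the strong metric dimension of the product\<close>

lemma card_ideals_eq:
  assumes "ring R" "finite {I. ideal I R}" "carrier R \<noteq> {\<zero>\<^bsub>R\<^esub>}"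
  shows "card {I. ideal I R} = card (nontrivial_ideals R) + 2"
proof -
  interpret ring R by fact
  have "{I. ideal I R} = nontrivial_ideals R \<union> {{\<zero>\<^bsub>R\<^esub>}, carrier R}"
    using zeroideal oneideal by (auto simp: nontrivial_ideals_def)
  moreover have "nontrivial_ideals R \<inter> {{\<zero>\<^bsub>R\<^esub>}, carrier R} = {}"
    by (auto simp: nontrivial_ideals_def)
  moreover have "finite (nontrivial_ideals R)"
    using assms(2) by (simp add: nontrivial_ideals_def)
  ultimately show ?thesis
    using assms(3) by (simp add: card_Un_disjoint)
qed

theorem theorem3p10:
  fixes R :: "('r, 'p) ring_scheme"
    and Rs :: "('a, 'q) ring_scheme list"
    and Fs :: "('b, 's) ring_scheme list"
    and m n :: nat
  assumes "m \<ge> 1" and "n \<ge> 1"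
    and "length Rs = m" and "length Fs = n"
    and "\<And>i. i < m \<Longrightarrow> local_ring (Rs ! i)"
    and "\<And>i. i < m \<Longrightarrow> principal_ideal_ring (Rs ! i)"
    and "\<And>i. i < m \<Longrightarrow> finite {I. ideal I (Rs ! i)}"
    and "\<And>i. i < m \<Longrightarrow> \<not> field (Rs ! i)"
    and "\<And>j. j < n \<Longrightarrow> field (Fs ! j)"
    and "cring R"
    and "R \<simeq> RDirProd (RDirProd_list Rs) (RDirProd_list Fs)"
  shows "int (sdim (with_proj (intersection_graph R))) =
    (\<Prod>i<m. int (card (nontrivial_ideals (Rs ! i))) + 2) * 2 ^ n - 2 ^ (m + n - 1) - 2"
proof -
  let ?S = "RDirProd_list Rs" and ?T = "RDirProd_list Fs"
  have loc: "local_ring A" "principal_ideal_ring A" "finite {I. ideal I A}" "\<not> field A"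
    if "A \<in> set Rs" for A
    using that assms(3,5-8) by (auto simp: in_set_conv_nth)
  have ringRs: "ring A" if "A \<in> set Rs" for A
    using loc(1)[OF that] by (simp add: local_ring_def cring.axioms(1))
  have fld: "field B" if "B \<in> set Fs" for B
    using that assms(4,9) by (auto simp: in_set_conv_nth)
  have ringFs: "ring B" if "B \<in> set Fs" for B
    using fld[OF that] by (simp add: field.axioms(1) domain.axioms(1) cring.axioms(1))
  have finFs: "finite {I. ideal I B}" if "B \<in> set Fs" for B
    using field.all_ideals[OF fld[OF that]] by simp
  have S: "ring ?S" and T: "ring ?T"
    using ringRs ringFs by (auto intro!: RDirProd_list_is_ring)
  have R: "ring R"
    using assms(10) by (rule cring.axioms(1))
  note P = RDirProd_ring[OF S T]
  obtain f where f: "f \<in> ring_iso R (RDirProd ?S ?T)"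
    using assms(11) unfolding is_ring_iso_def by blast
  \<comment> \<open>The inverse isomorphism carries the proper essential ideal from the product to
    \<open>R\<close>; supports and ideal counts are pulled back along \<open>f\<close>.\<close>
  obtain g where g: "g \<in> ring_iso (RDirProd ?S ?T) R"
    using ring_iso_set_sym[OF R f] by blast
  have idS: "finite {I. ideal I ?S}" "\<exists>s. ideal_support ?S (length Rs) s"
    "card {I. ideal I ?S} = (\<Prod>A\<leftarrow>Rs. card {I. ideal I A})"
    using ideals_RDirProd_list[OF ringRs loc(3) ideal_support_local_pir] loc by auto
  have idT: "finite {I. ideal I ?T}" "\<exists>s. ideal_support ?T (length Fs) s"
    "card {I. ideal I ?T} = (\<Prod>B\<leftarrow>Fs. card {I. ideal I B})"
    using ideals_RDirProd_list[OF ringFs finFs field.ideal_support_field] fld by auto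
  have fin: "finite {I. ideal I R}"
    using card_ideals_ring_iso(1)[OF R P f] card_ideals_RDirProd(1)[OF S T idS(1) idT(1)] by blast
  obtain s where s: "ideal_support R (m + n) s"
    using idS(2) idT(2) ideal_support_RDirProd[OF S T] ideal_support_ring_iso[OF R P f] assms(3,4)
    by metis
  \<comment> \<open>As m \<ge> 1, there is a local factor that is not a field; its maximal ideal
    gives the proper essential ideal of the whole product.\<close>
  obtain A As where Rs: "Rs = A # As"
    using assms(1,3) by (cases Rs) auto
  have "ring (RDirProd_list As)"
    using ringRs Rs by (auto intro!: RDirProd_list_is_ring)
  moreover have A: "A \<in> set Rs"
    using Rs by simp
  ultimately have "has_proper_essential_ideal ?S"
    using has_proper_essential_ideal_RDirProd[OF ringRs[OF A] _
        has_proper_essential_ideal_local_pir[OF loc[OF A]], of "RDirProd_list As"]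
      has_proper_essential_ideal_ring_iso[OF RDirProd_ring S[unfolded Rs] RDirProd_list_iso1]
      ringRs[OF A] Rs by simp
  then have ess: "has_proper_essential_ideal R"
    using has_proper_essential_ideal_ring_iso[OF P R g] has_proper_essential_ideal_RDirProd[OF S T]
    by blast
  have "(\<Prod>A\<leftarrow>Rs. card {I. ideal I A}) = (\<Prod>i<m. card {I. ideal I (Rs ! i)})"
    using assms(3) by (simp add: prod.list_conv_set_nth atLeast0LessThan)
  also have "\<dots> = (\<Prod>i<m. card (nontrivial_ideals (Rs ! i)) + 2)"
  proof (rule prod.cong)
    fix i assume "i \<in> {..<m}"
    then have "Rs ! i \<in> set Rs"
      using assms(3) by simp
    then show "card {I. ideal I (Rs ! i)} = card (nontrivial_ideals (Rs ! i)) + 2"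
      using card_ideals_eq ringRs loc local_ring_carrier_nontrivial by blast
  qed simp
  finally have cardS: "card {I. ideal I ?S} = (\<Prod>i<m. card (nontrivial_ideals (Rs ! i)) + 2)"
    using idS(3) by simp
  \<comment> \<open>Each field contributes exactly two ideals, whence the factor 2^n.\<close>
  have "map (\<lambda>B. card {I. ideal I B}) Fs = replicate n 2"
    using field.card_ideals[OF fld] assms(4) by (intro nth_equalityI) auto
  then have cardT: "card {I. ideal I ?T} = 2 ^ n"
    using idT(3) by simp
  have "card {I. ideal I R} = (\<Prod>i<m. card (nontrivial_ideals (Rs ! i)) + 2) * 2 ^ n"
    using card_ideals_ring_iso(2)[OF R P f] card_ideals_RDirProd(2)[OF S T] cardS cardT by simp
  moreover have "0 < m + n"
    using assms(1) by simp
  ultimately show ?thesis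
    using sdim_intersection_graph[OF R fin _ s ess] by (simp add: add.commute)
qed

end
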